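(* Let $k$ be a field, let $R=k[x_1,\ldots,x_n]$, let $s\ge1$, let $X=\{a_1,\ldots,a_s\}\subseteq k^n$ consist of (pairwise) distinct points, let $\nu:X\to\mathbb{N}_{>0}$, and put $q_i=\nu(a_i)$. Set $$J_{X,\nu}=\prod_{i=1}^{s}\mathfrak{m}_{a_i}^{q_i}.$$ Then, for every ideal $I$ of $R$, $$\Phi^{*}_{X,\nu}(I)=\bigcap_{i=1}^{s}\bigl(I+\mathfrak{m}_{a_i}^{q_i}\bigr)=I+J_{X,\nu}.$$ Moreover, $$J_{X,\nu}=\bigcap_{i=1}^{s}\mathfrak{m}_{a_i}^{q_i}.$$ Consequently, the restriction of $\Phi^{*}_{X,\nu}$ to the ideals of $R$ is translation $I\mapsto I+J_{X,\nu}$ by the fixed ideal $J_{X,\nu}$.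
   Context: For $a=(a_1,\ldots,a_n)\in k^n$, $\mathfrak{m}_a=(x_1-a_1,\ldots,x_n-a_n)\subseteq R$. For a subset $X\subseteq k^n$, a function $\nu:X\to\mathbb{N}_{>0}$ and a subset $A\subseteq R$, $\Phi^{*}_{X,\nu}(A)=\bigcap_{a\in X}\bigl(A+\mathfrak{m}_a^{\nu(a)}\bigr)$. *)

theory Defs
  imports "HOL-Algebra.Ideal_Product" "HOL-Library.Poly_Mapping" "HOL-Library.FuncSet"
begin

text \<open>
  Polynomials are finitely supported maps from monomials to coefficients, a monomial being a
  finitely supported exponent vector.  Since the number \<open>n\<close> of variables is an arbitrary natural
  number (possibly \<open>0\<close>) and not a type, \<open>k[x\<^sub>1,\<dots>,x\<^sub>n]\<close> is the subring, inside the polynomials in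
  the countably many variables indexed by \<^typ>\<open>nat\<close>, of those in which only the variables with
  index in \<open>{1..n}\<close> occur.
\<close>

type_synonym 'k mpoly_nat = "(nat \<Rightarrow>\<^sub>0 nat) \<Rightarrow>\<^sub>0 'k"

definition mpoly_ring :: "nat \<Rightarrow> ('k::field) mpoly_nat ring"
  where "mpoly_ring n =
    \<lparr> carrier = {p. \<forall>m \<in> Poly_Mapping.keys p. Poly_Mapping.keys m \<subseteq> {1..n}},
      mult = (*), one = 1, zero = 0, add = (+) \<rparr>"

definition mpoly_var :: "nat \<Rightarrow> ('k::field) mpoly_nat"
  where "mpoly_var i = Poly_Mapping.single (Poly_Mapping.single i 1) 1"

definition mpoly_const :: "'k::field \<Rightarrow> 'k mpoly_nat"
  where "mpoly_const c = Poly_Mapping.single 0 c"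

text \<open>
  The affine space \<open>k\<^sup>n\<close>; the extensional function space makes two points equal exactly when
  their coordinates with index in \<open>{1..n}\<close> agree.
\<close>

definition affine_space :: "nat \<Rightarrow> (nat \<Rightarrow> 'k::field) set"
  where "affine_space n = ({1..n} \<rightarrow>\<^sub>E UNIV)"

definition point_ideal :: "nat \<Rightarrow> (nat \<Rightarrow> 'k::field) \<Rightarrow> 'k mpoly_nat set"
  where "point_ideal n a =
    Idl\<^bsub>mpoly_ring n\<^esub> ((\<lambda>i. mpoly_var i - mpoly_const (a i)) ` {1..n})"

text \<open>Powers are taken in the multiplicative monoid of ideals, whose unit is the whole ring.\<close>

definition point_ideal_pow :: "nat \<Rightarrow> (nat \<Rightarrow> 'k::field) \<Rightarrow> nat \<Rightarrow> 'k mpoly_nat set"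
  where "point_ideal_pow n a q = point_ideal n a [^]\<^bsub>ideals_set (mpoly_ring n)\<^esub> q"

text \<open>
  Intersecting with the carrier only matters for \<open>X = {}\<close>, where the empty intersection of
  subsets of the polynomial ring is the whole ring.
\<close>

definition Phi_star ::
    "nat \<Rightarrow> (nat \<Rightarrow> 'k::field) set \<Rightarrow> ((nat \<Rightarrow> 'k) \<Rightarrow> nat) \<Rightarrow> 'k mpoly_nat set \<Rightarrow> 'k mpoly_nat set"
  where "Phi_star n X \<nu> A =
    carrier (mpoly_ring n) \<inter> (\<Inter>a\<in>X. A <+>\<^bsub>mpoly_ring n\<^esub> point_ideal_pow n a (\<nu> a))"

lemma mpoly_ring_mult_closed:
  assumes p: "p \<in> carrier (mpoly_ring n)" and r: "r \<in> carrier (mpoly_ring n)"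
  shows "p * r \<in> carrier (mpoly_ring n)"
proof -
  have "Poly_Mapping.keys m \<subseteq> {1..n}" if m: "m \<in> Poly_Mapping.keys (p * r)" for m
  proof -
    obtain u v where "m = u + v" "u \<in> Poly_Mapping.keys p" "v \<in> Poly_Mapping.keys r"
      using m keys_mult[of p r] by blast
    then show ?thesis
      using p r keys_add[of u v] unfolding mpoly_ring_def by fastforce
  qed
  then show ?thesis by (simp add: mpoly_ring_def)
qed

lemma mpoly_ring_cring: "cring (mpoly_ring n :: ('k::field) mpoly_nat ring)"
proof (rule cringI)
  show "abelian_group (mpoly_ring n :: 'k mpoly_nat ring)"
  proof (rule abelian_groupI)
    fix x y :: "'k mpoly_nat"
    assume "x \<in> carrier (mpoly_ring n)" "y \<in> carrier (mpoly_ring n)"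
    then show "x \<oplus>\<^bsub>mpoly_ring n\<^esub> y \<in> carrier (mpoly_ring n)"
      using keys_add[of x y] by (fastforce simp: mpoly_ring_def)
  next
    fix x :: "'k mpoly_nat"
    assume x: "x \<in> carrier (mpoly_ring n)"
    have "Poly_Mapping.keys (- x) = Poly_Mapping.keys x"
      by (auto simp: in_keys_iff)
    then have "- x \<in> carrier (mpoly_ring n)"
      using x by (simp add: mpoly_ring_def)
    moreover have "- x \<oplus>\<^bsub>mpoly_ring n\<^esub> x = \<zero>\<^bsub>mpoly_ring n\<^esub>"
      by (simp add: mpoly_ring_def)
    ultimately show "\<exists>y\<in>carrier (mpoly_ring n). y \<oplus>\<^bsub>mpoly_ring n\<^esub> x = \<zero>\<^bsub>mpoly_ring n\<^esub>"
      by blast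
  qed (auto simp: mpoly_ring_def algebra_simps)
  show "comm_monoid (mpoly_ring n :: 'k mpoly_nat ring)"
  proof (rule comm_monoidI)
    fix x y :: "'k mpoly_nat"
    assume "x \<in> carrier (mpoly_ring n)" "y \<in> carrier (mpoly_ring n)"
    then show "x \<otimes>\<^bsub>mpoly_ring n\<^esub> y \<in> carrier (mpoly_ring n)"
      using mpoly_ring_mult_closed[of x n y] by (simp add: mpoly_ring_def)
  qed (auto simp: mpoly_ring_def algebra_simps)
qed (auto simp: mpoly_ring_def algebra_simps)

lemma point_ideal_generators_in_carrier:
  "(\<lambda>i. mpoly_var i - mpoly_const (a i)) ` {1..n} \<subseteq> carrier (mpoly_ring n)"
proof -
  have "Poly_Mapping.keys m \<subseteq> {1..n}"
    if "m \<in> Poly_Mapping.keys (mpoly_var i - mpoly_const (a i))" "i \<in> {1..n}" for m i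
  proof (rule ccontr)
    assume "\<not> Poly_Mapping.keys m \<subseteq> {1..n}"
    then have "m \<noteq> 0" "m \<noteq> Poly_Mapping.single i 1" using that(2) by auto
    then have "Poly_Mapping.lookup (mpoly_var i - mpoly_const (a i)) m = 0"
      by (simp add: mpoly_var_def mpoly_const_def lookup_minus lookup_single)
    with that(1) show False by (simp add: in_keys_iff)
  qed
  then show ?thesis unfolding mpoly_ring_def by (auto simp del: atLeastAtMost_iff)
qed

end

theory Submission
  imports Defs
begin

text \<open>
  This is the Chinese remainder theorem with a fixed ideal \<open>I\<close> carried along.  Its two-factor form is
  an explicit computation.  Let \<open>K\<close> and \<open>L\<close> be comaximal, say \<open>1 = u + v\<close> with \<open>u \<in> K\<close> and \<open>v \<in> L\<close>.
  If \<open>x = i + k = j + l\<close> with \<open>i, j \<in> I\<close>, \<open>k \<in> K\<close> and \<open>l \<in> L\<close>, then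
  \<open>x = u x + v x = (u j + v i) + (u l + k v)\<close>, which lies in \<open>I + K L\<close>.
  Hence \<open>(I + K) \<inter> (I + L) = I + K L\<close> (\<open>add_ideal_Int_add_ideal\<close>).

  Products and powers of ideals comaximal to \<open>L\<close> are again comaximal to \<open>L\<close>, so the two-factor form
  extends by induction to a finite family of pairwise comaximal ideals
  (\<open>add_finprod_ideals_eq_INT\<close>).  With \<open>I = 0\<close> this says that the product of the family is
  its intersection.

  It remains to see that the powers of the ideals of two distinct points \<open>a\<close> and \<open>b\<close> are comaximal.
  The points differ in some coordinate \<open>t\<close>, and \<open>(x\<^sub>t - a\<^sub>t) - (x\<^sub>t - b\<^sub>t) = b\<^sub>t - a\<^sub>t\<close> is a nonzero constant,
  hence a unit (\<open>comaximal_point_ideals\<close>).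
\<close>

section \<open>Comaximal ideals in a commutative ring\<close>

context cring
begin

lemma comaximal_iff:
  assumes "ideal K R" "ideal L R"
  shows "K <+>\<^bsub>R\<^esub> L = carrier R \<longleftrightarrow> (\<exists>u\<in>K. \<exists>v\<in>L. \<one> = u \<oplus> v)"
proof
  assume "K <+>\<^bsub>R\<^esub> L = carrier R"
  then have "\<one> \<in> K <+>\<^bsub>R\<^esub> L" by simp
  then show "\<exists>u\<in>K. \<exists>v\<in>L. \<one> = u \<oplus> v" by (auto simp: set_add_def')
next
  assume "\<exists>u\<in>K. \<exists>v\<in>L. \<one> = u \<oplus> v"
  then have "\<one> \<in> K <+>\<^bsub>R\<^esub> L" by (auto simp: set_add_def')
  then show "K <+>\<^bsub>R\<^esub> L = carrier R"
    using ideal.one_imp_carrier[OF add_ideals[OF assms]] by simp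
qed

lemma comaximal_carrier:
  assumes "ideal L R"
  shows "carrier R <+>\<^bsub>R\<^esub> L = carrier R"
proof -
  have "\<zero> \<in> L"
    using additive_subgroup.zero_closed[OF ideal.axioms(1)[OF assms]] .
  moreover have "\<one> = \<one> \<oplus> \<zero>" by simp
  ultimately show ?thesis
    using comaximal_iff[OF oneideal assms] one_closed by blast
qed

lemma comaximal_commute:
  assumes "ideal K R" "ideal L R"
  shows "K <+>\<^bsub>R\<^esub> L = carrier R \<longleftrightarrow> L <+>\<^bsub>R\<^esub> K = carrier R"
  using set_add_comm[of K L] assms by (simp add: ideal.Icarr subsetI)

text \<open>Multiplying \<open>1 = u + v\<close> by \<open>1 = u' + v'\<close> leaves \<open>u u'\<close> plus an element of \<open>L\<close>.\<close>

lemma comaximal_ideal_prod: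
  assumes ideals: "ideal K R" "ideal K' R" "ideal L R"
    and "K <+>\<^bsub>R\<^esub> L = carrier R" "K' <+>\<^bsub>R\<^esub> L = carrier R"
  shows "(K \<cdot> K') <+>\<^bsub>R\<^esub> L = carrier R"
proof -
  obtain u v where uv: "u \<in> K" "v \<in> L" "\<one> = u \<oplus> v"
    using assms comaximal_iff by blast
  obtain u' v' where uv': "u' \<in> K'" "v' \<in> L" "\<one> = u' \<oplus> v'"
    using assms comaximal_iff by blast
  have carr: "u \<in> carrier R" "v \<in> carrier R" "u' \<in> carrier R" "v' \<in> carrier R"
    using ideal.Icarr[OF ideals(1) uv(1)] ideal.Icarr[OF ideals(3) uv(2)]
      ideal.Icarr[OF ideals(2) uv'(1)] ideal.Icarr[OF ideals(3) uv'(2)] .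
  have "\<one> = (u \<oplus> v) \<otimes> (u' \<oplus> v')"
    by (simp flip: uv(3) uv'(3))
  also have "\<dots> = u \<otimes> u' \<oplus> (u \<otimes> v' \<oplus> v \<otimes> (u' \<oplus> v'))"
    using carr by algebra
  finally have "\<one> = u \<otimes> u' \<oplus> (u \<otimes> v' \<oplus> v \<otimes> (u' \<oplus> v'))" .
  moreover have "u \<otimes> u' \<in> K \<cdot> K'"
    using uv uv' by (simp add: ideal_prod.prod)
  moreover have "u \<otimes> v' \<oplus> v \<otimes> (u' \<oplus> v') \<in> L"
    using ideals(3) uv uv' carr
    by (simp add: ideal.I_l_closed ideal.I_r_closed additive_subgroup.a_closed ideal.axioms(1))
  ultimately show ?thesis
    using comaximal_iff[OF ideal_prod_is_ideal[OF ideals(1,2)] ideals(3)] by blast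
qed

lemma ideal_pow_is_ideal:
  assumes "ideal K R"
  shows "ideal (K [^]\<^bsub>ideals_set R\<^esub> (m::nat)) R"
  by (induction m) (use assms in \<open>simp_all add: ideals_set_def oneideal ideal_prod_is_ideal\<close>)

lemma comaximal_ideal_pow_left:
  assumes "ideal K R" "ideal L R" "K <+>\<^bsub>R\<^esub> L = carrier R"
  shows "(K [^]\<^bsub>ideals_set R\<^esub> (m::nat)) <+>\<^bsub>R\<^esub> L = carrier R"
proof (induction m)
  case 0
  show ?case using comaximal_carrier[OF assms(2)] by (simp add: ideals_set_def)
next
  case (Suc m)
  then show ?case
    using comaximal_ideal_prod[OF ideal_pow_is_ideal[OF assms(1)] assms(1,2) _ assms(3)]
    by (simp add: ideals_set_def)
qed

lemma comaximal_ideal_pows: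
  assumes "ideal K R" "ideal L R" "K <+>\<^bsub>R\<^esub> L = carrier R"
  shows "(K [^]\<^bsub>ideals_set R\<^esub> (m::nat)) <+>\<^bsub>R\<^esub> (L [^]\<^bsub>ideals_set R\<^esub> (l::nat)) = carrier R"
  using assms comaximal_ideal_pow_left comaximal_commute ideal_pow_is_ideal by metis

lemma finprod_ideals_is_ideal:
  assumes "\<And>i. i \<in> A \<Longrightarrow> ideal (K i) R"
  shows "ideal (\<Otimes>\<^bsub>ideals_set R\<^esub> i\<in>A. K i) R"
  using comm_monoid.finprod_closed[OF ideals_set_is_comm_monoid, of K A] assms
  by (auto simp: ideals_set_def)

lemma finprod_ideals_insert:
  assumes "finite A" "j \<notin> A" "\<And>i. i \<in> insert j A \<Longrightarrow> ideal (K i) R"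
  shows "(\<Otimes>\<^bsub>ideals_set R\<^esub> i\<in>insert j A. K i) = K j \<cdot> (\<Otimes>\<^bsub>ideals_set R\<^esub> i\<in>A. K i)"
  using comm_monoid.finprod_insert[OF ideals_set_is_comm_monoid, of A j K] assms
  by (auto simp: ideals_set_def)

lemma finprod_ideals_empty: "(\<Otimes>\<^bsub>ideals_set R\<^esub> i\<in>{}. K i) = carrier R"
  using comm_monoid.finprod_empty[OF ideals_set_is_comm_monoid, of K]
  by (simp add: ideals_set_def)

lemma comaximal_finprod:
  assumes "finite A" "ideal L R"
    and "\<And>i. i \<in> A \<Longrightarrow> ideal (K i) R"
    and "\<And>i. i \<in> A \<Longrightarrow> K i <+>\<^bsub>R\<^esub> L = carrier R"
  shows "(\<Otimes>\<^bsub>ideals_set R\<^esub> i\<in>A. K i) <+>\<^bsub>R\<^esub> L = carrier R"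
  using assms(1,3,4)
proof (induction A rule: finite_induct)
  case empty
  show ?case using comaximal_carrier[OF assms(2)] by (simp add: finprod_ideals_empty)
next
  case (insert j A)
  then show ?case
    using comaximal_ideal_prod[of "K j" "\<Otimes>\<^bsub>ideals_set R\<^esub> i\<in>A. K i" L] assms(2)
      finprod_ideals_insert[of A j K]
    by (simp add: finprod_ideals_is_ideal)
qed


section \<open>The Chinese remainder theorem relative to an ideal\<close>

text \<open>
  For \<open>x\<close> in the intersection and \<open>1 = u + v\<close> with \<open>u \<in> K\<close>, \<open>v \<in> L\<close>, the summand \<open>u x\<close> is
  expanded with the representation of \<open>x\<close> modulo \<open>L\<close> and \<open>v x\<close> with the one modulo \<open>K\<close>, so
  that both remainders land in \<open>K L\<close>.
\<close>

lemma add_ideal_Int_add_ideal: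
  assumes ideals: "ideal I R" "ideal K R" "ideal L R"
    and comax: "K <+>\<^bsub>R\<^esub> L = carrier R"
  shows "(I <+>\<^bsub>R\<^esub> K) \<inter> (I <+>\<^bsub>R\<^esub> L) = I <+>\<^bsub>R\<^esub> (K \<cdot> L)"
proof
  show "I <+>\<^bsub>R\<^esub> (K \<cdot> L) \<subseteq> (I <+>\<^bsub>R\<^esub> K) \<inter> (I <+>\<^bsub>R\<^esub> L)"
    using ideal_prod_inter[OF ideals(2,3)] by (auto simp: set_add_def')
  show "(I <+>\<^bsub>R\<^esub> K) \<inter> (I <+>\<^bsub>R\<^esub> L) \<subseteq> I <+>\<^bsub>R\<^esub> (K \<cdot> L)"
  proof
    fix x assume "x \<in> (I <+>\<^bsub>R\<^esub> K) \<inter> (I <+>\<^bsub>R\<^esub> L)"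
    then obtain i k j l where x: "i \<in> I" "k \<in> K" "x = i \<oplus> k" "j \<in> I" "l \<in> L" "x = j \<oplus> l"
      by (auto simp: set_add_def')
    obtain u v where uv: "u \<in> K" "v \<in> L" "\<one> = u \<oplus> v"
      using comax comaximal_iff[OF ideals(2,3)] by blast
    have carr: "i \<in> carrier R" "k \<in> carrier R" "j \<in> carrier R" "l \<in> carrier R"
      "u \<in> carrier R" "v \<in> carrier R"
      using ideal.Icarr[OF ideals(1) x(1)] ideal.Icarr[OF ideals(2) x(2)]
        ideal.Icarr[OF ideals(1) x(4)] ideal.Icarr[OF ideals(3) x(5)]
        ideal.Icarr[OF ideals(2) uv(1)] ideal.Icarr[OF ideals(3) uv(2)] .
    have "x \<in> carrier R"
      using carr x(3) by simp
    then have "x = (u \<oplus> v) \<otimes> x"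
      by (simp flip: uv(3))
    also have "\<dots> = u \<otimes> x \<oplus> v \<otimes> x"
      using carr \<open>x \<in> carrier R\<close> by (simp add: l_distr)
    also have "\<dots> = u \<otimes> (j \<oplus> l) \<oplus> v \<otimes> (i \<oplus> k)"
      using x(3,6) by simp
    also have "\<dots> = (u \<otimes> j \<oplus> v \<otimes> i) \<oplus> (u \<otimes> l \<oplus> k \<otimes> v)"
      using carr by algebra
    finally have "x = (u \<otimes> j \<oplus> v \<otimes> i) \<oplus> (u \<otimes> l \<oplus> k \<otimes> v)" .
    moreover have "u \<otimes> j \<oplus> v \<otimes> i \<in> I"
      using ideals(1) x carr
      by (simp add: ideal.I_l_closed additive_subgroup.a_closed ideal.axioms(1))
    moreover have "u \<otimes> l \<oplus> k \<otimes> v \<in> K \<cdot> L"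
      using x uv by (simp add: ideal_prod.prod ideal_prod.sum)
    ultimately show "x \<in> I <+>\<^bsub>R\<^esub> (K \<cdot> L)"
      unfolding set_add_def' by blast
  qed
qed

text \<open>
  The carrier on the left gives the empty intersection its value in the ring, so that the
  induction can start from the empty family, whose product is the unit ideal.
\<close>

lemma add_finprod_ideals_eq_INT:
  assumes "finite A" "ideal I R"
    and "\<And>i. i \<in> A \<Longrightarrow> ideal (K i) R"
    and "\<And>i j. i \<in> A \<Longrightarrow> j \<in> A \<Longrightarrow> i \<noteq> j \<Longrightarrow> K i <+>\<^bsub>R\<^esub> K j = carrier R"
  shows "carrier R \<inter> (\<Inter>i\<in>A. I <+>\<^bsub>R\<^esub> K i) = I <+>\<^bsub>R\<^esub> (\<Otimes>\<^bsub>ideals_set R\<^esub> i\<in>A. K i)"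
  using assms(1,3,4)
proof (induction A rule: finite_induct)
  case empty
  show ?case
    using comaximal_carrier[OF assms(2)] comaximal_commute[OF oneideal assms(2)]
    by (simp add: finprod_ideals_empty)
next
  case (insert j A)
  let ?P = "\<Otimes>\<^bsub>ideals_set R\<^esub> i\<in>A. K i"
  have K: "ideal (K j) R" "ideal ?P R"
    using insert.prems(1) by (simp_all add: finprod_ideals_is_ideal)
  have "?P <+>\<^bsub>R\<^esub> K j = carrier R"
    using insert.hyps insert.prems K(1) by (intro comaximal_finprod) auto
  then have comax: "K j <+>\<^bsub>R\<^esub> ?P = carrier R"
    using comaximal_commute[OF K] by simp
  have "carrier R \<inter> (\<Inter>i\<in>insert j A. I <+>\<^bsub>R\<^esub> K i)
      = (I <+>\<^bsub>R\<^esub> K j) \<inter> (carrier R \<inter> (\<Inter>i\<in>A. I <+>\<^bsub>R\<^esub> K i))"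
    by auto
  also have "\<dots> = (I <+>\<^bsub>R\<^esub> K j) \<inter> (I <+>\<^bsub>R\<^esub> ?P)"
    using insert.IH insert.prems by simp
  also have "\<dots> = I <+>\<^bsub>R\<^esub> (K j \<cdot> ?P)"
    using add_ideal_Int_add_ideal[OF assms(2) K comax] .
  also have "K j \<cdot> ?P = (\<Otimes>\<^bsub>ideals_set R\<^esub> i\<in>insert j A. K i)"
    using finprod_ideals_insert[of A j K] insert.hyps insert.prems(1) by simp
  finally show ?case .
qed

lemma zero_add_ideal:
  assumes "ideal K R"
  shows "{\<zero>} <+>\<^bsub>R\<^esub> K = K"
  using ideal.Icarr[OF assms] by (auto simp: set_add_def')

end


section \<open>Ideals of points\<close>

lemma point_ideal_is_ideal: "ideal (point_ideal n a) (mpoly_ring n)"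
  unfolding point_ideal_def
  using ring.genideal_ideal[OF cring.axioms(1)[OF mpoly_ring_cring] point_ideal_generators_in_carrier] .

lemma point_ideal_pow_is_ideal: "ideal (point_ideal_pow n a m) (mpoly_ring n)"
  unfolding point_ideal_pow_def
  using cring.ideal_pow_is_ideal[OF mpoly_ring_cring point_ideal_is_ideal] .

lemma point_ideal_generator_mem:
  assumes "t \<in> {1..n}"
  shows "mpoly_var t - mpoly_const (a t) \<in> point_ideal n a"
  unfolding point_ideal_def
  using ring.genideal_self[OF cring.axioms(1)[OF mpoly_ring_cring] point_ideal_generators_in_carrier]
    assms by blast

lemma mpoly_const_in_carrier: "mpoly_const c \<in> carrier (mpoly_ring n)"
  by (auto simp: mpoly_ring_def mpoly_const_def)

text \<open>
  With \<open>c = b\<^sub>t - a\<^sub>t \<noteq> 0\<close>, the decomposition of \<open>1\<close> is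
  \<open>c\<inverse> (x\<^sub>t - a\<^sub>t) + (- c\<inverse>) (x\<^sub>t - b\<^sub>t)\<close>.
\<close>

lemma comaximal_point_ideals:
  assumes "t \<in> {1..n}" "a t \<noteq> b t"
  shows "point_ideal n a <+>\<^bsub>mpoly_ring n\<^esub> point_ideal n b = carrier (mpoly_ring n)"
proof -
  define c where "c = inverse (b t - a t)"
  let ?u = "mpoly_const c * (mpoly_var t - mpoly_const (a t))"
  let ?v = "mpoly_const (- c) * (mpoly_var t - mpoly_const (b t))"
  have mem: "mpoly_const d * p \<in> point_ideal n e" if "p \<in> point_ideal n e" for d p and e :: "nat \<Rightarrow> 'a"
    using ideal.I_l_closed[OF point_ideal_is_ideal that mpoly_const_in_carrier]
    by (simp add: mpoly_ring_def)
  have "?u \<in> point_ideal n a" "?v \<in> point_ideal n b"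
    using mem point_ideal_generator_mem[OF assms(1)] by blast+
  moreover have "?u + ?v = 1"
  proof -
    have const_neg: "mpoly_const (- c) = - mpoly_const c"
      by (simp add: mpoly_const_def single_uminus)
    have "?u + ?v = mpoly_const c * (mpoly_const (b t) - mpoly_const (a t))"
      by (simp add: const_neg algebra_simps)
    also have "\<dots> = mpoly_const (c * (b t - a t))"
      by (simp add: mpoly_const_def mult_single flip: single_diff)
    also have "c * (b t - a t) = 1"
      using assms(2) by (simp add: c_def)
    finally show ?thesis by (simp add: mpoly_const_def)
  qed
  ultimately have "\<exists>u\<in>point_ideal n a. \<exists>v\<in>point_ideal n b.
      \<one>\<^bsub>mpoly_ring n\<^esub> = u \<oplus>\<^bsub>mpoly_ring n\<^esub> v"
    by (intro bexI[of _ ?u] bexI[of _ ?v]) (simp_all add: mpoly_ring_def)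
  then show ?thesis
    using cring.comaximal_iff[OF mpoly_ring_cring point_ideal_is_ideal point_ideal_is_ideal] by blast
qed

lemma comaximal_point_ideal_pows:
  assumes "a \<in> affine_space n" "b \<in> affine_space n" "a \<noteq> b"
  shows "point_ideal_pow n a l <+>\<^bsub>mpoly_ring n\<^esub> point_ideal_pow n b m = carrier (mpoly_ring n)"
proof -
  obtain t where "t \<in> {1..n}" "a t \<noteq> b t"
    using assms unfolding affine_space_def by (meson PiE_ext)
  then show ?thesis
    unfolding point_ideal_pow_def
    using cring.comaximal_ideal_pows[OF mpoly_ring_cring point_ideal_is_ideal point_ideal_is_ideal]
      comaximal_point_ideals by blast
qed


section \<open>Translation by the product ideal\<close>

theorem proposition6p8:
  fixes n s :: nat
    and a :: "nat \<Rightarrow> (nat \<Rightarrow> 'k::field)"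
    and X :: "(nat \<Rightarrow> 'k) set"
    and \<nu> :: "(nat \<Rightarrow> 'k) \<Rightarrow> nat"
    and q :: "nat \<Rightarrow> nat"
    and J :: "'k mpoly_nat set"
  assumes "s \<ge> 1"
    and "X \<subseteq> affine_space n"
    and "X = a ` {1..s}"
    and "inj_on a {1..s}"
    and "\<forall>x\<in>X. \<nu> x > 0"
    and "\<forall>i\<in>{1..s}. q i = \<nu> (a i)"
    and "J = (\<Otimes>\<^bsub>ideals_set (mpoly_ring n)\<^esub> i\<in>{1..s}. point_ideal_pow n (a i) (q i))"
  shows "(\<forall>I. ideal I (mpoly_ring n) \<longrightarrow>
            Phi_star n X \<nu> I
              = (\<Inter>i\<in>{1..s}. I <+>\<^bsub>mpoly_ring n\<^esub> point_ideal_pow n (a i) (q i))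
          \<and> (\<Inter>i\<in>{1..s}. I <+>\<^bsub>mpoly_ring n\<^esub> point_ideal_pow n (a i) (q i))
              = I <+>\<^bsub>mpoly_ring n\<^esub> J)
       \<and> J = (\<Inter>i\<in>{1..s}. point_ideal_pow n (a i) (q i))
       \<and> ideal J (mpoly_ring n)
       \<and> restrict (Phi_star n X \<nu>) {I. ideal I (mpoly_ring n)}
           = (\<lambda>I\<in>{I. ideal I (mpoly_ring n)}. I <+>\<^bsub>mpoly_ring n\<^esub> J)"
proof -
  let ?R = "mpoly_ring n :: 'k mpoly_nat ring"
  let ?K = "\<lambda>i. point_ideal_pow n (a i) (q i)"
  interpret R: cring ?R by (rule mpoly_ring_cring)
  have K: "ideal (?K i) ?R" for i by (rule point_ideal_pow_is_ideal)
  have comax: "?K i <+>\<^bsub>?R\<^esub> ?K j = carrier ?R" if "i \<in> {1..s}" "j \<in> {1..s}" "i \<noteq> j" for i j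
    using that assms(2-4) by (intro comaximal_point_ideal_pows) (auto dest: inj_onD)
  have J: "ideal J ?R"
    unfolding assms(7) using K by (rule R.finprod_ideals_is_ideal)
  have crt: "carrier ?R \<inter> (\<Inter>i\<in>{1..s}. I <+>\<^bsub>?R\<^esub> ?K i) = I <+>\<^bsub>?R\<^esub> J" if "ideal I ?R" for I
    unfolding assms(7) using that K comax by (intro R.add_finprod_ideals_eq_INT) auto
  \<comment> \<open>Since \<open>s \<ge> 1\<close>, the intersection over \<open>{1..s}\<close> already lies in the ring.\<close>
  have carr: "(\<Inter>i\<in>{1..s}. I <+>\<^bsub>?R\<^esub> ?K i) \<subseteq> carrier ?R" if "ideal I ?R" for I
    using assms(1) ideal.Icarr[OF R.add_ideals[OF that K[of 1]]] by fastforce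
  have inter: "(\<Inter>i\<in>{1..s}. I <+>\<^bsub>?R\<^esub> ?K i) = I <+>\<^bsub>?R\<^esub> J" if "ideal I ?R" for I
    using crt[OF that] carr[OF that] by blast
  have Phi: "Phi_star n X \<nu> I = (\<Inter>i\<in>{1..s}. I <+>\<^bsub>?R\<^esub> ?K i)" if "ideal I ?R" for I
    using carr[OF that] assms(3,6) unfolding Phi_star_def by auto
  have "(\<Inter>i\<in>{1..s}. ?K i) = J"
    using inter[OF R.zeroideal] by (simp add: R.zero_add_ideal K J)
  then show ?thesis
    using inter Phi J by (auto simp: fun_eq_iff restrict_def)
qed

end
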